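(* Let $\alpha$ be a $(p,q)$ torus curve with $p,q\neq 0$ on a standard torus of revolution with radii $b$ and $1$, $0<b<1$. Then $\alpha$ has points of zero curvature for only one value of $b$, namely $b=\frac{p^2}{p^2+q^2}$. Moreover, for this value of $b$ there are precisely $q$ points of vanishing curvature on $\alpha$, all lying on the innermost longitudinal circle of the torus.
   Context: The standard torus of revolution with radii $b$ and $1$ is the surface $T\subset\mathbb{R}^3$ obtained by revolving a circle of radius $b$ about the $z$-axis, with the center of the circle at distance $1$ from the axis. It is parametrized by $x(u,v)=((1+b\cos v)\cos u,\ (1+b\cos v)\sin u,\ b\sin v)$. A $(p,q)$ torus curve $\alpha$ in $T$ is a curve that wraps around $T$ $p$ times in the horizontal direction and $q$ times in the vertical direction; it is parametrized by $\alpha(t)=\bigl((1+b\cos(qt))\cos(pt),\ (1+b\cos(qt))\sin(pt),\ b\sin(qt)\bigr)$, $t\in[0,2\pi]$. The innermost longitudinal circle of $T$ is the set of points of $T$ with $\cos v=-1$, i.e. $\{(x,y,0): x^2+y^2=(1-b)^2\}$. The curvature of $\alpha$ is its usual curvature as a regular space curve, $\kappa=\left\|\frac{d^2\alpha}{ds^2}\right\|$, where $s$ is arc length. *)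

theory Defs
  imports "HOL-Analysis.Analysis"
begin

definition torus_param :: "real \<Rightarrow> real \<Rightarrow> real \<Rightarrow> real^3" where
  "torus_param b u v = vector [(1 + b * cos v) * cos u, (1 + b * cos v) * sin u, b * sin v]"

definition innermost_circle :: "real \<Rightarrow> (real^3) set" where
  "innermost_circle b = {torus_param b u v |u v. cos v = -1}"

(* The parametrization is taken on all of \<real>, so that two-sided derivatives exist at every
   parameter; the closed curve is traversed once as t runs through {0..<2*pi}. *)
definition torus_curve :: "int \<Rightarrow> int \<Rightarrow> real \<Rightarrow> real \<Rightarrow> real^3" where
  "torus_curve p q b t =
     vector [(1 + b * cos (of_int q * t)) * cos (of_int p * t),
             (1 + b * cos (of_int q * t)) * sin (of_int p * t),
             b * sin (of_int q * t)]"

(* Signed arc length measured from parameter 0; the interval integral is negative for t < 0. *)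
definition arc_length :: "(real \<Rightarrow> 'a::euclidean_space) \<Rightarrow> real \<Rightarrow> real" where
  "arc_length \<alpha> t = (LBINT \<tau>=ereal 0..ereal t. norm (vector_derivative \<alpha> (at \<tau>)))"

(* Meaningful for regular curves defined on \<real>, where arc_length is injective with open range. *)
definition arc_length_param :: "(real \<Rightarrow> 'a::euclidean_space) \<Rightarrow> real \<Rightarrow> 'a" where
  "arc_length_param \<alpha> = \<alpha> \<circ> inv (arc_length \<alpha>)"

(* The norm of the second derivative with respect to arc length, at the point with parameter t.
   Meaningful for regular C^2 curves on \<real>: vector_derivative is unspecified where the
   derivative does not exist. *)
definition curvature :: "(real \<Rightarrow> 'a::euclidean_space) \<Rightarrow> real \<Rightarrow> real" where
  "curvature \<alpha> t =
     norm (vector_derivative (\<lambda>s. vector_derivative (arc_length_param \<alpha>) (at s))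
             (at (arc_length \<alpha> t)))"

(* The half-open period ensures that the common endpoint of the closed curve is counted once. *)
definition zero_curvature_params :: "int \<Rightarrow> int \<Rightarrow> real \<Rightarrow> real set" where
  "zero_curvature_params p q b = {t \<in> {0..<2 * pi}. curvature (torus_curve p q b) t = 0}"

end

theory Submission
  imports Defs
begin

text \<open>
  With respect to a parameter that need not be arc length, a regular curve has curvature zero
  exactly where its acceleration is a real multiple of its velocity. For the torus curve this
  condition becomes transparent in the orthonormal frame (radial, angular, vertical) that
  rotates with the longitude \<open>p t\<close>. Writing \<open>w = 1 + b cos (q t)\<close> for the distance
  from the axis, the velocity has the coordinates \<open>(w', p w, b q cos (q t))\<close> and the
  acceleration \<open>(w'' - p\<^sup>2 w, 2 p w', - b q\<^sup>2 sin (q t))\<close>. Comparing the angular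
  coordinates determines the factor, \<open>2 w' / w\<close>. The vertical coordinates then
  give \<open>sin (q t) (1 - b cos (q t)) = 0\<close>, so \<open>sin (q t) = 0\<close> since \<open>b < 1\<close>, and
  the factor vanishes. What is left is \<open>w'' = p\<^sup>2 w\<close>: it is impossible on the
  outer equator, where \<open>cos (q t) = 1\<close>, and on the inner one, where \<open>cos (q t) = - 1\<close>, it reads
  \<open>b q\<^sup>2 = p\<^sup>2 (1 - b)\<close>.

  Hence for the critical \<open>b\<close> the zeros of the curvature are the parameters with
  \<open>cos (q t) = - 1\<close>, the \<open>\<bar>q\<bar>\<close> odd multiples of \<open>\<pi> / \<bar>q\<bar>\<close> in a period.
  When \<open>p\<close> and \<open>q\<close> are coprime these parameters give different points because
  multiplication by \<open>p\<close> permutes the residues modulo \<open>q\<close>.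
\<close>

section \<open>Curvature of a regular curve in an arbitrary parameter\<close>

locale regular_C2_curve =
  fixes \<alpha> \<alpha>' \<alpha>'' :: "real \<Rightarrow> 'a::euclidean_space"
  assumes velocity: "\<And>t. (\<alpha> has_vector_derivative \<alpha>' t) (at t)"
    and acceleration: "\<And>t. (\<alpha>' has_vector_derivative \<alpha>'' t) (at t)"
    and regular: "\<And>t. \<alpha>' t \<noteq> 0"
begin

lemma arc_length_has_derivative:
  "(arc_length \<alpha> has_vector_derivative norm (\<alpha>' t)) (at t)"
proof -
  (* An interval with both the base point 0 and t in its interior, so that the fundamental theorem
     applies and yields a two-sided derivative at t. *)
  define a c where "a = min t 0 - 1" and "c = max t 0 + 1"
  have bounds: "a < t" "t < c" "a < 0" "0 < c"
    by (auto simp: a_def c_def)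
  have "continuous_on UNIV \<alpha>'"
    using acceleration by (meson continuous_at_imp_continuous_on has_vector_derivative_continuous)
  then have "continuous_on {a..c} (\<lambda>\<tau>. norm (\<alpha>' \<tau>))"
    by (intro continuous_on_norm) (rule continuous_on_subset, auto)
  then have "((\<lambda>u. LBINT \<tau>=0..u. norm (\<alpha>' \<tau>)) has_vector_derivative norm (\<alpha>' t))
      (at t within {a..c})"
    using interval_integral_FTC2[of a 0 c _ t] bounds by (simp add: zero_ereal_def)
  moreover have "arc_length \<alpha> = (\<lambda>u. LBINT \<tau>=0..u. norm (\<alpha>' \<tau>))"
    using vector_derivative_at[OF velocity]
    by (auto simp: arc_length_def fun_eq_iff zero_ereal_def)
  ultimately show ?thesis
    using bounds by (simp add: at_within_Icc_at)
qed

lemma inj_arc_length: "inj (arc_length \<alpha>)"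
proof (rule injI, rule ccontr)
  have less: "arc_length \<alpha> x < arc_length \<alpha> y" if "x < y" for x y
    using that arc_length_has_derivative regular
    by (intro DERIV_pos_imp_increasing[OF that])
       (metis has_real_derivative_iff_has_vector_derivative zero_less_norm_iff)
  fix x y assume "arc_length \<alpha> x = arc_length \<alpha> y" "x \<noteq> y"
  then show False
    using less[of x y] less[of y x] by linarith
qed

lemma inv_arc_length [simp]: "inv (arc_length \<alpha>) (arc_length \<alpha> t) = t"
  by (rule inv_f_f[OF inj_arc_length])

lemma continuous_arc_length: "continuous_on UNIV (arc_length \<alpha>)"
  using arc_length_has_derivative
  by (meson continuous_at_imp_continuous_on has_vector_derivative_continuous)

lemma open_map_arc_length: "open T \<Longrightarrow> open (arc_length \<alpha> ` T)"
  using injective_eq_1d_open_map_UNIV[OF continuous_arc_length] inj_arc_length by auto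

text \<open>An injective continuous map of the line is open, so the inverse of arc length is continuous
  and defined near every value of arc length, even if the curve has finite length.\<close>

lemma inv_arc_length_has_derivative:
  "(inv (arc_length \<alpha>) has_vector_derivative inverse (norm (\<alpha>' t))) (at (arc_length \<alpha> t))"
proof -
  have "continuous_on (range (arc_length \<alpha>)) (inv (arc_length \<alpha>))"
    by (rule continuous_on_inverse_open_map[OF continuous_arc_length refl])
       (auto intro: open_map_arc_length open_subset)
  then show ?thesis
    unfolding has_vector_derivative_def
    using arc_length_has_derivative[unfolded has_vector_derivative_def]
    by (intro has_derivative_inverse_dieudonne[OF open_UNIV open_map_arc_length,
          where f' = "\<lambda>x. x *\<^sub>R norm (\<alpha>' t)"])
       (auto simp: continuous_arc_length bounded_linear_scaleR_left fun_eq_iff regular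
          bounded_linear_mult_left)
qed

text \<open>Changing to arc length divides the derivative by the speed.\<close>

lemma derivative_wrt_arc_length:
  assumes "(f has_vector_derivative f') (at t)"
  shows "(f \<circ> inv (arc_length \<alpha>) has_vector_derivative f' /\<^sub>R norm (\<alpha>' t)) (at (arc_length \<alpha> t))"
  using vector_diff_chain_at[OF inv_arc_length_has_derivative, of f f' t] assms by simp

lemma unit_tangent:
  "vector_derivative (arc_length_param \<alpha>) (at (arc_length \<alpha> t)) = \<alpha>' t /\<^sub>R norm (\<alpha>' t)"
  unfolding arc_length_param_def
  by (rule vector_derivative_at[OF derivative_wrt_arc_length[OF velocity]])

lemma unit_tangent_has_derivative:
  "((\<lambda>t. \<alpha>' t /\<^sub>R norm (\<alpha>' t)) has_vector_derivative
     (\<alpha>'' t - ((\<alpha>' t \<bullet> \<alpha>'' t) / (norm (\<alpha>' t))\<^sup>2) *\<^sub>R \<alpha>' t) /\<^sub>R norm (\<alpha>' t)) (at t)"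
proof -
  have norm_derivative:
    "((\<lambda>t. norm (\<alpha>' t)) has_derivative (\<lambda>h. (h *\<^sub>R \<alpha>'' t) \<bullet> sgn (\<alpha>' t))) (at t)"
    using has_derivative_compose[OF acceleration[unfolded has_vector_derivative_def]
        has_derivative_norm[OF regular]]
    by simp
  have "((\<lambda>t. norm (\<alpha>' t)) has_field_derivative (\<alpha>' t \<bullet> \<alpha>'' t) / norm (\<alpha>' t)) (at t)"
    unfolding has_field_derivative_def
    by (rule has_derivative_eq_rhs[OF norm_derivative])
       (simp add: fun_eq_iff sgn_div_norm inner_commute field_simps)
  then have "((\<lambda>t. inverse (norm (\<alpha>' t))) has_field_derivative
      - (((\<alpha>' t \<bullet> \<alpha>'' t) / norm (\<alpha>' t)) / (norm (\<alpha>' t))\<^sup>2)) (at t)"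
    using regular by (auto intro!: derivative_eq_intros simp: field_simps power2_eq_square)
  from has_vector_derivative_scaleR[OF this acceleration]
  show ?thesis
    by (rule has_vector_derivative_eq_rhs) (simp add: algebra_simps divide_inverse)
qed

text \<open>The curvature vector is the component of the acceleration normal to the velocity,
  divided by the square of the speed.\<close>

lemma curvature_eq:
  "curvature \<alpha> t =
     norm (\<alpha>'' t - ((\<alpha>' t \<bullet> \<alpha>'' t) / (norm (\<alpha>' t))\<^sup>2) *\<^sub>R \<alpha>' t) / (norm (\<alpha>' t))\<^sup>2"
proof -
  let ?T = "\<lambda>t. \<alpha>' t /\<^sub>R norm (\<alpha>' t)"
  let ?N = "\<alpha>'' t - ((\<alpha>' t \<bullet> \<alpha>'' t) / (norm (\<alpha>' t))\<^sup>2) *\<^sub>R \<alpha>' t"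
  have "((\<lambda>s. vector_derivative (arc_length_param \<alpha>) (at s)) has_vector_derivative
      (?N /\<^sub>R norm (\<alpha>' t)) /\<^sub>R norm (\<alpha>' t)) (at (arc_length \<alpha> t))"
    by (rule has_vector_derivative_transform_within_open
        [OF derivative_wrt_arc_length[OF unit_tangent_has_derivative] open_map_arc_length[OF open_UNIV]])
       (auto simp: unit_tangent)
  then have "curvature \<alpha> t = norm ((?N /\<^sub>R norm (\<alpha>' t)) /\<^sub>R norm (\<alpha>' t))"
    unfolding curvature_def by (subst vector_derivative_at) auto
  then show ?thesis
    by (simp add: divide_inverse power2_eq_square)
qed

lemma curvature_eq_0_iff: "curvature \<alpha> t = 0 \<longleftrightarrow> (\<exists>c. \<alpha>'' t = c *\<^sub>R \<alpha>' t)"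
proof
  assume "curvature \<alpha> t = 0"
  then show "\<exists>c. \<alpha>'' t = c *\<^sub>R \<alpha>' t"
    using regular[of t] by (auto simp: curvature_eq)
next
  assume "\<exists>c. \<alpha>'' t = c *\<^sub>R \<alpha>' t"
  then obtain c where "\<alpha>'' t = c *\<^sub>R \<alpha>' t" ..
  then show "curvature \<alpha> t = 0"
    using regular[of t] by (simp add: curvature_eq dot_square_norm)
qed

end

section \<open>The rotating cylindrical frame\<close>

text \<open>Here \<open>x\<close>, \<open>y\<close> and \<open>z\<close> are the radial, angular and vertical coordinates with respect
  to the cylindrical frame at longitude \<open>\<theta>\<close>.\<close>

definition frame_vec :: "real \<Rightarrow> real \<Rightarrow> real \<Rightarrow> real \<Rightarrow> real^3" where
  "frame_vec \<theta> x y z = vector [x * cos \<theta> - y * sin \<theta>, x * sin \<theta> + y * cos \<theta>, z]"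

lemma frame_vec_scaleR: "c *\<^sub>R frame_vec \<theta> x y z = frame_vec \<theta> (c * x) (c * y) (c * z)"
  by (simp add: frame_vec_def vec_eq_iff forall_3 algebra_simps)

lemma frame_vec_eq_iff:
  "frame_vec \<theta> x y z = frame_vec \<theta> x' y' z' \<longleftrightarrow> x = x' \<and> y = y' \<and> z = z'"
proof
  assume eq: "frame_vec \<theta> x y z = frame_vec \<theta> x' y' z'"
  have coords: "x * cos \<theta> - y * sin \<theta> = x' * cos \<theta> - y' * sin \<theta>"
    "x * sin \<theta> + y * cos \<theta> = x' * sin \<theta> + y' * cos \<theta>" "z = z'"
    using eq by (auto simp: frame_vec_def vec_eq_iff forall_3)
  (* Rotating back by \<theta> recovers the coordinates. *)
  have rotate_back:
    "(u * cos \<theta> - v * sin \<theta>) * cos \<theta> + (u * sin \<theta> + v * cos \<theta>) * sin \<theta> = u"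
    "(u * sin \<theta> + v * cos \<theta>) * cos \<theta> - (u * cos \<theta> - v * sin \<theta>) * sin \<theta> = v" for u v
    using sin_cos_squared_add[of \<theta>] by algebra+
  show "x = x' \<and> y = y' \<and> z = z'"
    using rotate_back[of x y] rotate_back[of x' y'] coords by simp
qed simp

text \<open>The frame turns with speed \<open>k\<close>, which adds the cross terms \<open>- k y\<close> and
  \<open>k x\<close> to the derivatives of the coordinates.\<close>

lemma frame_vec_has_derivative:
  assumes "(x has_field_derivative x') (at t)" "(y has_field_derivative y') (at t)"
    "(z has_field_derivative z') (at t)"
  shows "((\<lambda>t. frame_vec (k * t) (x t) (y t) (z t)) has_vector_derivative
      frame_vec (k * t) (x' - k * y t) (y' + k * x t) z') (at t)"
proof -
  have "((\<lambda>t. x t * cos (k * t) - y t * sin (k * t)) has_field_derivative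
      (x' - k * y t) * cos (k * t) - (y' + k * x t) * sin (k * t)) (at t)"
    by (auto intro!: derivative_eq_intros assms simp: algebra_simps)
  moreover have "((\<lambda>t. x t * sin (k * t) + y t * cos (k * t)) has_field_derivative
      (x' - k * y t) * sin (k * t) + (y' + k * x t) * cos (k * t)) (at t)"
    by (auto intro!: derivative_eq_intros assms simp: algebra_simps)
  ultimately have "\<forall>i. ((\<lambda>t. frame_vec (k * t) (x t) (y t) (z t) $ i) has_field_derivative
      frame_vec (k * t) (x' - k * y t) (y' + k * x t) z' $ i) (at t)"
    using assms(3) by (simp add: forall_3 frame_vec_def)
  then show ?thesis
    unfolding has_real_derivative_iff_has_vector_derivative has_vector_derivative_def
      has_derivative_componentwise_within[where f = "\<lambda>t. frame_vec (k * t) (x t) (y t) (z t)"]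
    by (auto simp: Basis_vec_def inner_axis)
qed

section \<open>Zero curvature on a torus curve\<close>

lemma torus_curve_eq_frame_vec:
  "torus_curve p q b t = frame_vec (of_int p * t) (1 + b * cos (of_int q * t)) 0 (b * sin (of_int q * t))"
  by (simp add: torus_curve_def frame_vec_def)

definition torus_velocity :: "int \<Rightarrow> int \<Rightarrow> real \<Rightarrow> real \<Rightarrow> real^3" where
  "torus_velocity p q b t = frame_vec (of_int p * t)
     (- b * of_int q * sin (of_int q * t))
     (of_int p * (1 + b * cos (of_int q * t)))
     (b * of_int q * cos (of_int q * t))"

definition torus_acceleration :: "int \<Rightarrow> int \<Rightarrow> real \<Rightarrow> real \<Rightarrow> real^3" where
  "torus_acceleration p q b t = frame_vec (of_int p * t)
     (- b * (of_int q)\<^sup>2 * cos (of_int q * t) - (of_int p)\<^sup>2 * (1 + b * cos (of_int q * t)))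
     (- 2 * b * of_int p * of_int q * sin (of_int q * t))
     (- b * (of_int q)\<^sup>2 * sin (of_int q * t))"

lemma one_plus_mult_cos_pos:
  fixes b x :: real
  assumes "0 < b" "b < 1"
  shows "0 < 1 + b * cos x"
proof -
  have "b * (- cos x) \<le> b * 1"
    using assms cos_ge_minus_one[of x] by (intro mult_left_mono) auto
  then show ?thesis
    using assms by simp
qed

lemma regular_torus_curve:
  assumes "p \<noteq> 0" "0 < b" "b < 1"
  shows "regular_C2_curve (torus_curve p q b) (torus_velocity p q b) (torus_acceleration p q b)"
proof
  fix t
  show "(torus_curve p q b has_vector_derivative torus_velocity p q b t) (at t)"
    unfolding torus_curve_eq_frame_vec[abs_def] torus_velocity_def
    by (rule has_vector_derivative_eq_rhs, rule frame_vec_has_derivative)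
       (auto intro!: derivative_eq_intros simp: frame_vec_eq_iff)
  show "(torus_velocity p q b has_vector_derivative torus_acceleration p q b t) (at t)"
    unfolding torus_velocity_def[abs_def] torus_acceleration_def
    by (rule has_vector_derivative_eq_rhs, rule frame_vec_has_derivative)
       (auto intro!: derivative_eq_intros simp: frame_vec_eq_iff power2_eq_square algebra_simps)
  (* The angular coordinate p w of the velocity is nonzero; as 0 *\<^sub>R v stands for the zero vector,
     the two sides can be compared coordinatewise. *)
  have "0 *\<^sub>R torus_velocity p q b t \<noteq> torus_velocity p q b t"
    unfolding torus_velocity_def frame_vec_scaleR frame_vec_eq_iff
    using one_plus_mult_cos_pos[OF assms(2,3), of "of_int q * t"] assms(1) by simp
  then show "torus_velocity p q b t \<noteq> 0"
    by auto
qed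

lemma torus_curvature_eq_0_iff:
  fixes p q :: int
  assumes "p \<noteq> 0" "q \<noteq> 0" "0 < b" "b < 1"
  shows "curvature (torus_curve p q b) t = 0 \<longleftrightarrow>
    cos (of_int q * t) = - 1 \<and> b = (of_int p)\<^sup>2 / ((of_int p)\<^sup>2 + (of_int q)\<^sup>2)"
proof -
  interpret regular_C2_curve "torus_curve p q b" "torus_velocity p q b" "torus_acceleration p q b"
    by (rule regular_torus_curve) (use assms in auto)
  define P Q C S w where "P = real_of_int p" and "Q = real_of_int q"
    and "C = cos (Q * t)" and "S = sin (Q * t)" and "w = 1 + b * C"
  have PQ: "P \<noteq> 0" "Q \<noteq> 0" and "w > 0" and pythagoras: "S\<^sup>2 + C\<^sup>2 = 1"
    using assms one_plus_mult_cos_pos by (auto simp: P_def Q_def C_def S_def w_def)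
  have critical_iff: "b = P\<^sup>2 / (P\<^sup>2 + Q\<^sup>2) \<longleftrightarrow> b * (P\<^sup>2 + Q\<^sup>2) = P\<^sup>2"
    using PQ by (intro nonzero_eq_divide_eq) (simp add: sum_power2_eq_zero_iff)
  have "curvature (torus_curve p q b) t = 0 \<longleftrightarrow>
      (\<exists>c. - b * Q\<^sup>2 * C - P\<^sup>2 * w = c * (- b * Q * S) \<and> - 2 * b * P * Q * S = c * (P * w)
         \<and> - b * Q\<^sup>2 * S = c * (b * Q * C))" (is "_ \<longleftrightarrow> (\<exists>c. ?parallel c)")
    unfolding curvature_eq_0_iff torus_acceleration_def torus_velocity_def frame_vec_scaleR
      frame_vec_eq_iff P_def Q_def C_def S_def w_def ..
  also have "\<dots> \<longleftrightarrow> C = - 1 \<and> b = P\<^sup>2 / (P\<^sup>2 + Q\<^sup>2)"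
  proof
    assume "\<exists>c. ?parallel c"
    then obtain c where c: "?parallel c" ..
    have "P * (c * w + 2 * b * Q * S) = 0" "(b * Q) * (c * C + Q * S) = 0"
      using c by algebra+
    then have angular: "c * w + 2 * b * Q * S = 0" and vertical: "c * C + Q * S = 0"
      using PQ assms(3) by simp_all
    have "Q * S * (1 - b * C) = 0"
      using angular vertical unfolding w_def by algebra
    (* 1 - b C is the distance from the axis half a turn further along the meridian. *)
    moreover have "1 - b * C > 0"
      using one_plus_mult_cos_pos[OF assms(3,4), of "Q * t + pi"] by (simp add: C_def)
    ultimately have "S = 0"
      using PQ by simp
    then have radial: "b * Q\<^sup>2 * C = - (P\<^sup>2 * w)"
      using c by simp
    moreover have "P\<^sup>2 * w > 0" "b * Q\<^sup>2 > 0"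
      using PQ \<open>w > 0\<close> assms by auto
    ultimately have "C < 0"
      by (metis neg_less_0_iff_less zero_less_mult_pos2 not_less_iff_gr_or_eq mult_eq_0_iff
          mult_pos_pos less_asym)
    then have "C = - 1"
      using pythagoras \<open>S = 0\<close> by (auto simp: power2_eq_1_iff)
    moreover from this have "b * (P\<^sup>2 + Q\<^sup>2) = P\<^sup>2"
      using radial by (simp add: w_def algebra_simps)
    ultimately show "C = - 1 \<and> b = P\<^sup>2 / (P\<^sup>2 + Q\<^sup>2)"
      unfolding critical_iff by simp
  next
    assume critical: "C = - 1 \<and> b = P\<^sup>2 / (P\<^sup>2 + Q\<^sup>2)"
    then have "b * (P\<^sup>2 + Q\<^sup>2) = P\<^sup>2"
      unfolding critical_iff by simp
    moreover have "S = 0"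
      using critical pythagoras by simp
    moreover have "C = - 1"
      using critical ..
    ultimately have "?parallel 0"
      by (simp add: w_def algebra_simps)
    then show "\<exists>c. ?parallel c" ..
  qed
  finally show ?thesis
    by (simp add: P_def Q_def C_def)
qed

section \<open>Counting the zeros\<close>

text \<open>The parameters at which the curve meets the inner equator. With \<open>\<bar>q\<bar>\<close> in place of
  \<open>q\<close>, the values for \<open>k < \<bar>q\<bar>\<close> lie in the first period whatever the sign of \<open>q\<close>.\<close>

definition inner_param :: "int \<Rightarrow> nat \<Rightarrow> real" where
  "inner_param q k = (2 * real k + 1) * pi / \<bar>of_int q\<bar>"

lemma inner_params_in_period:
  fixes q :: int
  assumes "q \<noteq> 0"
  shows "{t \<in> {0..<2 * pi}. cos (of_int q * t) = - 1} = inner_param q ` {..<nat \<bar>q\<bar>}"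
proof (intro equalityI subsetI)
  let ?Q = "\<bar>real_of_int q\<bar>"
  have Q: "?Q > 0" "?Q = of_int \<bar>q\<bar>"
    using assms by auto
  have cos_abs: "cos (of_int q * t) = cos (?Q * t)" for t
    using cos_abs_real[of "of_int q * t"] cos_abs_real[of "?Q * t"] by (simp add: abs_mult)
  fix t
  {
    assume t: "t \<in> {t \<in> {0..<2 * pi}. cos (of_int q * t) = - 1}"
    then have "cos (?Q * t) = - 1"
      unfolding cos_abs by simp
    then obtain n :: int where n: "?Q * t = (2 * real_of_int n + 1) * pi"
      unfolding cos_eq_minus1 by auto
    have "0 \<le> ?Q * t" "?Q * t < ?Q * (2 * pi)"
      using t by (intro mult_nonneg_nonneg, simp_all) (intro mult_strict_left_mono Q(1), simp)
    then have "0 * pi \<le> (2 * real_of_int n + 1) * pi" "(2 * real_of_int n + 1) * pi < (2 * ?Q) * pi"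
      unfolding n by (simp_all only: mult_ac mult_zero_left)
    then have "0 \<le> 2 * real_of_int n + 1" "2 * real_of_int n + 1 < 2 * ?Q"
      using pi_gt_zero by (meson mult_le_cancel_right_pos mult_less_cancel_right_pos)+
    then have "0 \<le> n" "n < \<bar>q\<bar>"
      unfolding Q(2) by linarith+
    moreover have "t = inner_param q (nat n)"
    proof -
      have "t = (?Q * t) / ?Q"
        using Q(1) by simp
      also have "\<dots> = inner_param q (nat n)"
        unfolding n inner_param_def using \<open>0 \<le> n\<close> by simp
      finally show ?thesis .
    qed
    ultimately show "t \<in> inner_param q ` {..<nat \<bar>q\<bar>}"
      by auto
  }
  {
    assume "t \<in> inner_param q ` {..<nat \<bar>q\<bar>}"
    then obtain k where k: "k < nat \<bar>q\<bar>" and t: "t = inner_param q k"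
      by auto
    have "?Q * t = (2 * real k + 1) * pi"
      using Q(1) by (simp add: t inner_param_def)
    then have "cos (of_int q * t) = - 1"
      unfolding cos_abs cos_eq_minus1 by (intro exI[of _ "int k"]) simp
    moreover have "2 * real k + 1 < 2 * ?Q"
      using k unfolding Q(2) by linarith
    then have "(2 * real k + 1) * pi < (2 * ?Q) * pi"
      by simp
    then have "t < 2 * pi"
      using Q(1) unfolding t inner_param_def by (subst pos_divide_less_eq) (auto simp only: mult_ac)
    moreover have "0 \<le> t"
      by (simp add: t inner_param_def)
    ultimately show "t \<in> {t \<in> {0..<2 * pi}. cos (of_int q * t) = - 1}"
      by simp
  }
qed

lemma inj_inner_param: "q \<noteq> 0 \<Longrightarrow> inj (inner_param q)"
  by (auto simp: inj_def inner_param_def)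

text \<open>On the inner equator a point is determined by its longitude \<open>p t\<close> modulo
  \<open>2 \<pi>\<close>. The longitudes of the \<open>k\<close>-th and the \<open>l\<close>-th parameter differ by
  \<open>2 \<pi> p (k - l) / \<bar>q\<bar>\<close>, so they agree only if \<open>q\<close> divides \<open>p (k - l)\<close>.\<close>

lemma inj_on_inner_points:
  fixes p q :: int
  assumes "q \<noteq> 0" "b < 1" "coprime p q"
  shows "inj_on (torus_curve p q b) (inner_param q ` {..<nat \<bar>q\<bar>})"
proof (rule inj_onI, clarify)
  fix k l
  assume kl: "k < nat \<bar>q\<bar>" "l < nat \<bar>q\<bar>"
    and eq: "torus_curve p q b (inner_param q k) = torus_curve p q b (inner_param q l)"
  let ?Q = "\<bar>real_of_int q\<bar>"
  have Q: "?Q > 0"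
    using assms by auto
  have "cos (of_int q * inner_param q i) = - 1" if "i < nat \<bar>q\<bar>" for i
    using inner_params_in_period[OF assms(1)] that by blast
  then have "(1 - b) * cos (p * inner_param q k) = (1 - b) * cos (p * inner_param q l)"
    "(1 - b) * sin (p * inner_param q k) = (1 - b) * sin (p * inner_param q l)"
    using eq kl by (auto simp: torus_curve_def vec_eq_iff forall_3)
  then have "sin (p * inner_param q k) = sin (p * inner_param q l)
      \<and> cos (p * inner_param q k) = cos (p * inner_param q l)"
    using assms by simp
  then obtain n :: int where "p * inner_param q k = p * inner_param q l + 2 * pi * n"
    unfolding sin_cos_eq_iff by blast
  then have "p * ((2 * real k + 1) * pi) = p * ((2 * real l + 1) * pi) + 2 * pi * n * ?Q"
    using Q by (simp add: inner_param_def field_simps)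
  then have "(2 * pi) * (p * (real k - real l)) = (2 * pi) * (n * ?Q)"
    by (simp add: algebra_simps)
  then have "real_of_int (p * (int k - int l)) = real_of_int (n * \<bar>q\<bar>)"
    by (simp del: mult_cancel_left add: mult_left_cancel)
  then have "p * (int k - int l) = n * \<bar>q\<bar>"
    by (simp only: of_int_eq_iff)
  then have "q dvd p * (int k - int l)"
    by simp
  then have "q dvd int k - int l"
    using assms(3) by (simp add: coprime_commute coprime_dvd_mult_right_iff)
  then have "int k = int l"
    using kl zdvd_imp_le[of "\<bar>q\<bar>" "\<bar>int k - int l\<bar>"] by fastforce
  then show "inner_param q k = inner_param q l"
    by simp
qed

theorem theorem2p1:
  fixes p q :: int
  assumes "p \<noteq> 0" and "q \<noteq> 0"
  shows "{b::real. 0 < b \<and> b < 1 \<and> zero_curvature_params p q b \<noteq> {}}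
           = {(of_int p)\<^sup>2 / ((of_int p)\<^sup>2 + (of_int q)\<^sup>2)}
       \<and> (\<forall>b::real. b = (of_int p)\<^sup>2 / ((of_int p)\<^sup>2 + (of_int q)\<^sup>2) \<longrightarrow>
            card (zero_curvature_params p q b) = nat \<bar>q\<bar>
          \<and> (coprime p q \<longrightarrow>
               card (torus_curve p q b ` zero_curvature_params p q b) = nat \<bar>q\<bar>)
          \<and> torus_curve p q b ` zero_curvature_params p q b \<subseteq> innermost_circle b)"
proof -
  define b\<^sub>0 :: real where "b\<^sub>0 = (of_int p)\<^sup>2 / ((of_int p)\<^sup>2 + (of_int q)\<^sup>2)"
  have b\<^sub>0: "0 < b\<^sub>0" "b\<^sub>0 < 1"
    using assms by (auto simp: b\<^sub>0_def divide_less_eq sum_power2_gt_zero_iff)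
  have zero_iff: "curvature (torus_curve p q b) t = 0 \<longleftrightarrow> cos (of_int q * t) = - 1 \<and> b = b\<^sub>0"
    if "0 < b" "b < 1" for b t
    using torus_curvature_eq_0_iff[OF assms that] by (simp add: b\<^sub>0_def)
  have zeros: "zero_curvature_params p q b\<^sub>0 = inner_param q ` {..<nat \<bar>q\<bar>}"
    using inner_params_in_period[OF assms(2)] zero_iff[OF b\<^sub>0] by (simp add: zero_curvature_params_def)
  have card_zeros: "card (zero_curvature_params p q b\<^sub>0) = nat \<bar>q\<bar>"
    unfolding zeros using inj_inner_param[OF assms(2)] by (simp add: card_image inj_on_subset)
  have "card (torus_curve p q b\<^sub>0 ` zero_curvature_params p q b\<^sub>0) = nat \<bar>q\<bar>" if "coprime p q"
    using card_image[OF inj_on_inner_points[OF assms(2) b\<^sub>0(2) that]] card_zeros zeros by simp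
  moreover have "torus_curve p q b\<^sub>0 ` zero_curvature_params p q b\<^sub>0 \<subseteq> innermost_circle b\<^sub>0"
  proof (clarsimp simp: zero_curvature_params_def zero_iff[OF b\<^sub>0])
    fix t :: real
    assume "cos (of_int q * t) = - 1"
    then show "torus_curve p q b\<^sub>0 t \<in> innermost_circle b\<^sub>0"
      unfolding innermost_circle_def
      by (intro CollectI exI[of _ "of_int p * t"] exI[of _ "of_int q * t"])
         (simp add: torus_curve_def torus_param_def)
  qed
  moreover have "{b. 0 < b \<and> b < 1 \<and> zero_curvature_params p q b \<noteq> {}} = {b\<^sub>0}"
  proof -
    have "zero_curvature_params p q b\<^sub>0 \<noteq> {}"
      using card_zeros assms(2) by force
    moreover have "b = b\<^sub>0" if "0 < b" "b < 1" "zero_curvature_params p q b \<noteq> {}" for b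
      using zero_iff that by (auto simp: zero_curvature_params_def)
    ultimately show ?thesis
      using b\<^sub>0 by blast
  qed
  ultimately show ?thesis
    using card_zeros unfolding b\<^sub>0_def by blast
qed

end
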